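(* Let $\mathbb{F}$ be a field, let $d\in\mathbb{N}=\{0,1,2,\dots\}$, and let $V$ be a $(d+1)$-dimensional $\mathbb{F}$-vector space. Let $A:V\to V$ be a multiplicity-free $\mathbb{F}$-linear map, with a fixed ordering $\theta_0,\dots,\theta_d$ of its eigenvalues. For $0\le i\le d$ pick a nonzero vector $\mathbf{v}_i$ in the $\theta_i$-eigenspace of $A$, and let $\mathbf{v}=\mathbf{v}_0+\mathbf{v}_1+\cdots+\mathbf{v}_d$. For $(r,s,t)\in\Delta_d$ define $\mathcal{L}_{(r,s,t)}=\eta_r(A)\tau_t(A)\mathbf{v}\in V$. Then $\mathcal{L}:\Delta_d\to V$, $\lambda\mapsto\mathcal{L}_\lambda$, is a Concrete Billiard Array on $V$.
   Context: $A$ is multiplicity-free if it is diagonalizable and every eigenspace has dimension 1. Polynomials: for $0\le k\le d$, $\tau_k(\xi)=\prod_{i=1}^{k}(\xi-\theta_{i-1})$ and $\eta_k(\xi)=\prod_{i=1}^{k}(\xi-\theta_{d-i+1})$, with $\tau_0=\eta_0=1$. $\Delta_d=\{(r,s,t)\mid r,s,t\in\mathbb{N},\ r+s+t=d\}$; its elements are called locations. A line in $\Delta_d$ is a subset of $\Delta_d$ all of whose elements share the same value in a common coordinate (first, second, or third). Two locations are adjacent if they agree in one coordinate and differ by 1 in each of the other two. A 3-clique is a set of three mutually adjacent locations. The black 3-cliques are those of the form $\{(r,s,t),(r+1,s-1,t),(r,s-1,t+1)\}$ with $(r,s,t)\in\Delta_d$, $s\ge 1$. A Concrete Billiard Array on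 $V$ is a function $\mathcal{B}:\Delta_d\to V$, $\lambda\mapsto\mathcal{B}_\lambda$, such that (i) for each line $L$ in $\Delta_d$ the vectors $\{\mathcal{B}_\lambda\}_{\lambda\in L}$ are linearly independent; (ii) for each black 3-clique $C$ in $\Delta_d$ the vectors $\{\mathcal{B}_\lambda\}_{\lambda\in C}$ are linearly dependent. *)

theory Defs
  imports "HOL-Computational_Algebra.Polynomial"
begin

text \<open>
  The space \<open>V\<close> is the whole type \<open>'b\<close>, with scalar multiplication \<open>scale\<close> over the field \<open>'a\<close>.
  Since \<^const>\<open>vector_space.dim\<close> is \<open>0\<close> on spaces without a finite basis, the condition
  \<open>dim UNIV = d + 1\<close> entails finite-dimensionality.
\<close>

section \<open>Eigenspaces, multiplicity-free maps, polynomials in a linear map\<close>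

definition eigenspace ::
  "('a::field \<Rightarrow> 'b::ab_group_add \<Rightarrow> 'b) \<Rightarrow> ('b \<Rightarrow> 'b) \<Rightarrow> 'a \<Rightarrow> 'b set" where
  "eigenspace scale A c = {x. A x = scale c x}"

definition eigenvalues ::
  "('a::field \<Rightarrow> 'b::ab_group_add \<Rightarrow> 'b) \<Rightarrow> ('b \<Rightarrow> 'b) \<Rightarrow> 'a set" where
  "eigenvalues scale A = {c. \<exists>x. x \<noteq> 0 \<and> x \<in> eigenspace scale A c}"

definition diagonalizable ::
  "('a::field \<Rightarrow> 'b::ab_group_add \<Rightarrow> 'b) \<Rightarrow> ('b \<Rightarrow> 'b) \<Rightarrow> bool" where
  "diagonalizable scale A \<longleftrightarrow>
     (\<exists>B. \<not> module.dependent scale B \<and> module.span scale B = UNIV \<and>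
        (\<forall>x\<in>B. \<exists>c. x \<in> eigenspace scale A c))"

definition multiplicity_free ::
  "('a::field \<Rightarrow> 'b::ab_group_add \<Rightarrow> 'b) \<Rightarrow> ('b \<Rightarrow> 'b) \<Rightarrow> bool" where
  "multiplicity_free scale A \<longleftrightarrow>
     diagonalizable scale A \<and>
     (\<forall>c\<in>eigenvalues scale A. vector_space.dim scale (eigenspace scale A c) = 1)"

definition poly_map ::
  "('a::field \<Rightarrow> 'b::ab_group_add \<Rightarrow> 'b) \<Rightarrow> 'a poly \<Rightarrow> ('b \<Rightarrow> 'b) \<Rightarrow> 'b \<Rightarrow> 'b" where
  "poly_map scale p A x = (\<Sum>i\<le>degree p. scale (coeff p i) ((A ^^ i) x))"

definition tau_poly :: "(nat \<Rightarrow> 'a::field) \<Rightarrow> nat \<Rightarrow> 'a poly" where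
  "tau_poly \<theta> k = (\<Prod>i=1..k. [:- \<theta> (i - 1), 1:])"

text \<open>Used only for \<open>k \<le> d\<close>, where the subtraction does not truncate.\<close>

definition eta_poly :: "nat \<Rightarrow> (nat \<Rightarrow> 'a::field) \<Rightarrow> nat \<Rightarrow> 'a poly" where
  "eta_poly d \<theta> k = (\<Prod>i=1..k. [:- \<theta> (d - i + 1), 1:])"

section \<open>Locations, lines and cliques\<close>

type_synonym location = "nat \<times> nat \<times> nat"

definition Delta :: "nat \<Rightarrow> location set" where
  "Delta d = {(r, s, t). r + s + t = d}"

definition is_line :: "nat \<Rightarrow> location set \<Rightarrow> bool" where
  "is_line d L \<longleftrightarrow> L \<subseteq> Delta d \<and>
     ((\<exists>c. \<forall>(r, s, t)\<in>L. r = c) \<or> (\<exists>c. \<forall>(r, s, t)\<in>L. s = c) \<or> (\<exists>c. \<forall>(r, s, t)\<in>L. t = c))"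

definition differ_by_1 :: "nat \<Rightarrow> nat \<Rightarrow> bool" where
  "differ_by_1 x y \<longleftrightarrow> x = y + 1 \<or> y = x + 1"

fun adjacent :: "location \<Rightarrow> location \<Rightarrow> bool" where
  "adjacent (r, s, t) (r', s', t') \<longleftrightarrow>
     r = r' \<and> differ_by_1 s s' \<and> differ_by_1 t t' \<or>
     s = s' \<and> differ_by_1 r r' \<and> differ_by_1 t t' \<or>
     t = t' \<and> differ_by_1 r r' \<and> differ_by_1 s s'"

definition is_3_clique :: "nat \<Rightarrow> location set \<Rightarrow> bool" where
  "is_3_clique d C \<longleftrightarrow> C \<subseteq> Delta d \<and> card C = 3 \<and> (\<forall>x\<in>C. \<forall>y\<in>C. x \<noteq> y \<longrightarrow> adjacent x y)"

definition is_black_3_clique :: "nat \<Rightarrow> location set \<Rightarrow> bool" where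
  "is_black_3_clique d C \<longleftrightarrow> is_3_clique d C \<and>
     (\<exists>r s t. (r, s, t) \<in> Delta d \<and> s \<ge> 1 \<and>
        C = {(r, s, t), (r + 1, s - 1, t), (r, s - 1, t + 1)})"

text \<open>The first conjunct above is redundant:\<close>

lemma is_black_3_clique_iff:
  "is_black_3_clique d C \<longleftrightarrow>
     (\<exists>r s t. (r, s, t) \<in> Delta d \<and> s \<ge> 1 \<and>
        C = {(r, s, t), (r + 1, s - 1, t), (r, s - 1, t + 1)})"
  by (auto simp: is_black_3_clique_def is_3_clique_def Delta_def differ_by_1_def)

section \<open>Concrete Billiard Arrays\<close>

text \<open>
  Linear independence of an indexed family; a repeated vector makes the family dependent, even if
  the set of its values is independent.
\<close>

definition independent_family ::
  "('a::field \<Rightarrow> 'b::ab_group_add \<Rightarrow> 'b) \<Rightarrow> ('i \<Rightarrow> 'b) \<Rightarrow> 'i set \<Rightarrow> bool" where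
  "independent_family scale f I \<longleftrightarrow> inj_on f I \<and> \<not> module.dependent scale (f ` I)"

text \<open>Only the values on \<^term>\<open>Delta d\<close> matter.\<close>

definition concrete_billiard_array ::
  "('a::field \<Rightarrow> 'b::ab_group_add \<Rightarrow> 'b) \<Rightarrow> nat \<Rightarrow> (location \<Rightarrow> 'b) \<Rightarrow> bool" where
  "concrete_billiard_array scale d B \<longleftrightarrow>
     (\<forall>L. is_line d L \<longrightarrow> independent_family scale B L) \<and>
     (\<forall>C. is_black_3_clique d C \<longrightarrow> \<not> independent_family scale B C)"

definition billiard_L ::
  "('a::field \<Rightarrow> 'b::ab_group_add \<Rightarrow> 'b) \<Rightarrow>
   nat \<Rightarrow> (nat \<Rightarrow> 'a) \<Rightarrow> ('b \<Rightarrow> 'b) \<Rightarrow> 'b \<Rightarrow> location \<Rightarrow> 'b" where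
  "billiard_L scale d \<theta> A v =
     (\<lambda>(r, s, t). poly_map scale (eta_poly d \<theta> r) A (poly_map scale (tau_poly \<theta> t) A v))"

end

theory Submission
  imports Defs
begin

text \<open>
  Eigenvectors \<open>v\<^sub>0, \<dots>, v\<^sub>d\<close> for distinct eigenvalues are independent, and \<open>\<L>\<close> at \<open>(r, s, t)\<close>
  is \<open>\<Sum>\<^sub>i \<eta>\<^sub>r(\<theta>\<^sub>i) \<tau>\<^sub>t(\<theta>\<^sub>i) v\<^sub>i\<close>, whose coefficients are nonzero exactly for \<open>t \<le> i \<le> d - r\<close>. On a line
  with constant first or second coordinate the smallest support index \<open>t\<close> is injective, on a line
  with constant third coordinate the largest support index \<open>d - r\<close> is; so the coefficient matrix of a
  line is triangular. On a black clique, \<open>\<eta>\<^sub>r\<^sub>+\<^sub>1 \<tau>\<^sub>t - \<eta>\<^sub>r \<tau>\<^sub>t\<^sub>+\<^sub>1 = (\<theta>\<^sub>t - \<theta>\<^sub>d\<^sub>-\<^sub>r) \<eta>\<^sub>r \<tau>\<^sub>t\<close>.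
\<close>

context vector_space
begin

lemma independent_family_iff:
  assumes fin: "finite I"
  shows "independent_family scale f I \<longleftrightarrow>
    (\<forall>a. (\<Sum>i\<in>I. scale (a i) (f i)) = 0 \<longrightarrow> (\<forall>i\<in>I. a i = 0))"
    (is "_ \<longleftrightarrow> ?R")
proof
  assume "independent_family scale f I"
  then have inj: "inj_on f I" and ind: "independent (f ` I)"
    by (simp_all add: independent_family_def)
  show ?R
  proof (intro allI impI ballI)
    fix a i
    assume sum0: "(\<Sum>i\<in>I. scale (a i) (f i)) = 0" and i: "i \<in> I"
    have "(\<Sum>x\<in>f ` I. scale (a (the_inv_into I f x)) x) = (\<Sum>i\<in>I. scale (a i) (f i))"
      by (simp add: sum.reindex[OF inj] the_inv_into_f_f[OF inj] cong: sum.cong)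
    with sum0 ind have "\<forall>x\<in>f ` I. a (the_inv_into I f x) = 0"
      using fin by (auto simp: dependent_finite)
    with i show "a i = 0"
      by (auto simp: the_inv_into_f_f[OF inj])
  qed
next
  assume R: ?R
  have inj: "inj_on f I"
  proof (rule inj_onI, rule ccontr)
    fix i j
    assume ij: "i \<in> I" "j \<in> I" "f i = f j" "i \<noteq> j"
    define a where "a k = (if k = i then 1 else if k = j then - 1 else 0 :: 'a)" for k
    have "(\<Sum>k\<in>I. scale (a k) (f k)) = (\<Sum>k\<in>{i, j}. scale (a k) (f k))"
      using ij fin by (intro sum.mono_neutral_right) (auto simp: a_def)
    also have "\<dots> = 0"
      using ij by (simp add: a_def)
    finally have "a i = 0"
      using R ij by blast
    then show False
      by (simp add: a_def)
  qed
  have "u x = 0" if "(\<Sum>x\<in>f ` I. scale (u x) x) = 0" "x \<in> f ` I" for u x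
    using R[rule_format, of "u \<circ> f"] that by (auto simp: sum.reindex[OF inj])
  with inj show "independent_family scale f I"
    using fin by (auto simp: independent_family_def dependent_finite)
qed

text \<open>With the rows \<open>l\<close> ranked by \<open>\<rho>\<close>, the columns
  \<open>\<pi> l\<close> form a triangular matrix with nonzero diagonal. A relation is then solved
  row by row, from the smallest rank upwards.\<close>

lemma independent_family_triangular:
  fixes \<rho> :: "'i \<Rightarrow> nat" and c :: "'i \<Rightarrow> 'k \<Rightarrow> 'a"
  assumes K: "finite K" "independent_family scale v K"
    and L: "finite L" "inj_on \<rho> L"
    and f: "\<And>l. l \<in> L \<Longrightarrow> f l = (\<Sum>k\<in>K. scale (c l k) (v k))"
    and pivot: "\<And>l. l \<in> L \<Longrightarrow> \<pi> l \<in> K" "\<And>l. l \<in> L \<Longrightarrow> c l (\<pi> l) \<noteq> 0"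
    and zero: "\<And>l l'. l \<in> L \<Longrightarrow> l' \<in> L \<Longrightarrow> \<rho> l < \<rho> l' \<Longrightarrow> c l' (\<pi> l) = 0"
  shows "independent_family scale f L"
  unfolding independent_family_iff[OF L(1)]
proof (intro allI impI)
  fix a
  assume sum0: "(\<Sum>l\<in>L. scale (a l) (f l)) = 0"
  have "(\<Sum>l\<in>L. scale (a l) (f l)) = (\<Sum>l\<in>L. \<Sum>k\<in>K. scale (a l * c l k) (v k))"
    by (simp add: f scale_sum_right cong: sum.cong)
  also have "\<dots> = (\<Sum>k\<in>K. scale (\<Sum>l\<in>L. a l * c l k) (v k))"
    by (subst sum.swap) (simp add: scale_sum_left)
  finally have coeff: "(\<Sum>l\<in>L. a l * c l k) = 0" if "k \<in> K" for k
    using sum0 K that by (auto simp: independent_family_iff)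
  have "l \<in> L \<longrightarrow> a l = 0" for l
  proof (induction "\<rho> l" arbitrary: l rule: less_induct)
    case less
    show ?case
    proof
      assume l: "l \<in> L"
      \<comment> \<open>In column \<open>\<pi> l\<close>, rows of smaller rank drop out by
        induction, rows of larger rank by \<open>zero\<close>.\<close>
      have "a l' * c l' (\<pi> l) = 0" if "l' \<in> L - {l}" for l'
      proof (cases "\<rho> l' < \<rho> l")
        case True
        with less that show ?thesis by auto
      next
        case False
        moreover have "\<rho> l' \<noteq> \<rho> l"
          using L(2) l that by (auto dest: inj_onD)
        ultimately show ?thesis
          using zero[of l l'] l that by simp
      qed
      then have "(\<Sum>l'\<in>L. a l' * c l' (\<pi> l)) = a l * c l (\<pi> l)"
        using l L(1) by (subst sum.remove[of _ l]) (simp_all add: sum.neutral)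
      then show "a l = 0"
        using coeff[of "\<pi> l"] pivot l by simp
    qed
  qed
  then show "\<forall>l\<in>L. a l = 0" by blast
qed

text \<open>On a \<theta>-eigenvector, \<open>p(A)\<close> acts as the scalar
  \<open>p(\<theta>)\<close>. The free coefficients \<open>a\<close> allow the formula to be applied
  twice in succession.\<close>

lemma poly_map_eigenvector_sum:
  assumes A: "Vector_Spaces.linear scale scale A"
    and v: "\<And>i. i \<in> I \<Longrightarrow> v i \<in> eigenspace scale A (\<theta> i)"
  shows "poly_map scale p A (\<Sum>i\<in>I. scale (a i) (v i)) =
    (\<Sum>i\<in>I. scale (poly p (\<theta> i) * a i) (v i))"
proof -
  interpret A: Vector_Spaces.linear scale scale A by fact
  have pow: "(A ^^ n) (\<Sum>i\<in>I. scale (a i) (v i)) = (\<Sum>i\<in>I. scale (\<theta> i ^ n * a i) (v i))" for n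
  proof (induction n)
    case (Suc n)
    have "A (v i) = scale (\<theta> i) (v i)" if "i \<in> I" for i
      using v[OF that] by (simp add: eigenspace_def)
    with Suc show ?case
      by (auto simp: A.sum A.scale mult_ac intro!: sum.cong)
  qed simp
  have "poly_map scale p A (\<Sum>i\<in>I. scale (a i) (v i)) =
      (\<Sum>n\<le>degree p. \<Sum>i\<in>I. scale (coeff p n * \<theta> i ^ n * a i) (v i))"
    by (simp add: poly_map_def pow scale_sum_right mult_ac)
  also have "\<dots> = (\<Sum>i\<in>I. scale (poly p (\<theta> i) * a i) (v i))"
    by (subst sum.swap) (simp add: poly_altdef sum_distrib_right scale_sum_left)
  finally show ?thesis .
qed

text \<open>Applying \<open>q(A)\<close>, where \<open>q\<close> has as roots the eigenvalues other
  than \<open>\<theta> i\<close>, to a relation leaves only its \<open>i\<close>-th term.\<close>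

lemma independent_family_eigenvectors:
  assumes A: "Vector_Spaces.linear scale scale A"
    and I: "finite I" "inj_on \<theta> I"
    and v: "\<And>i. i \<in> I \<Longrightarrow> v i \<noteq> 0" "\<And>i. i \<in> I \<Longrightarrow> v i \<in> eigenspace scale A (\<theta> i)"
  shows "independent_family scale v I"
  unfolding independent_family_iff[OF I(1)]
proof (intro allI impI ballI)
  fix a i
  assume sum0: "(\<Sum>i\<in>I. scale (a i) (v i)) = 0" and i: "i \<in> I"
  define q where "q = (\<Prod>j\<in>I - {i}. [:- \<theta> j, 1:])"
  have q0: "poly q (\<theta> j) = 0" if "j \<in> I - {i}" for j
    using that I(1) by (auto simp: q_def poly_prod)
  \<comment> \<open>The zero vector is the empty sum of eigenvectors.\<close>
  have "poly_map scale q A 0 = 0"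
    using poly_map_eigenvector_sum[OF A, where I = "{}" and p = q] by simp
  then have "0 = (\<Sum>j\<in>I. scale (poly q (\<theta> j) * a j) (v j))"
    using poly_map_eigenvector_sum[where v = v and \<theta> = \<theta>, OF A v(2), of I q a] sum0 by simp
  also have "\<dots> = scale (poly q (\<theta> i) * a i) (v i)"
    using i I(1) q0 by (simp add: sum.remove)
  finally have "poly q (\<theta> i) * a i = 0"
    using v(1)[OF i] by simp
  moreover have "poly q (\<theta> i) \<noteq> 0"
    using i I by (auto simp: q_def poly_prod dest: inj_onD)
  ultimately show "a i = 0" by simp
qed

end

lemma poly_tau_eq_0_iff:
  assumes "inj_on \<theta> {0..d}" "i \<le> d" "k \<le> d"
  shows "poly (tau_poly \<theta> k) (\<theta> i) = 0 \<longleftrightarrow> i < k"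
proof -
  have "poly (tau_poly \<theta> k) (\<theta> i) = 0 \<longleftrightarrow> (\<exists>j\<in>{1..k}. \<theta> i = \<theta> (j - 1))"
    by (simp add: tau_poly_def poly_prod)
  also have "\<dots> \<longleftrightarrow> (\<exists>j\<in>{1..k}. i = j - 1)"
    using assms by (intro bex_cong refl) (auto simp: inj_on_eq_iff)
  \<comment> \<open>The roots are \<open>\<theta> 0\<close>, ..., \<open>\<theta> (k - 1)\<close>;
    the product counts from 1, so the root \<open>\<theta> i\<close> comes from the factor
    \<open>Suc i\<close>.\<close>
  also have "\<dots> \<longleftrightarrow> i < k"
    by (auto intro!: bexI[of _ "Suc i"])
  finally show ?thesis .
qed

lemma poly_eta_eq_0_iff:
  assumes "inj_on \<theta> {0..d}" "i \<le> d" "k \<le> d"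
  shows "poly (eta_poly d \<theta> k) (\<theta> i) = 0 \<longleftrightarrow> d - k < i"
proof -
  have "poly (eta_poly d \<theta> k) (\<theta> i) = 0 \<longleftrightarrow> (\<exists>j\<in>{1..k}. \<theta> i = \<theta> (d - j + 1))"
    by (simp add: eta_poly_def poly_prod)
  also have "\<dots> \<longleftrightarrow> (\<exists>j\<in>{1..k}. i = d - j + 1)"
    using assms by (intro bex_cong refl inj_on_eq_iff) auto
  \<comment> \<open>The roots are \<open>\<theta> (d - k + 1)\<close>, ...,
    \<open>\<theta> d\<close>; the factor with root \<open>\<theta> i\<close> is found by solving
    \<open>i = d - j + 1\<close> for \<open>j\<close>.\<close>
  also have "\<dots> \<longleftrightarrow> d - k < i"
    using assms by (auto intro!: bexI[of _ "Suc d - i"])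
  finally show ?thesis .
qed

lemma finite_Delta: "finite (Delta d)"
  by (rule finite_subset[of _ "{..d} \<times> {..d} \<times> {..d}"]) (auto simp: Delta_def)

text \<open>Since \<open>r + s + t = d\<close>, any two coordinates determine the third. Hence
  \<open>t\<close> separates the points of a line with fixed \<open>r\<close> or \<open>s\<close>,
  and \<open>r\<close> those of a line with fixed \<open>t\<close>.\<close>

lemma is_line_cases:
  assumes "is_line d L"
  obtains "inj_on (\<lambda>(r, s, t). t) L" | "inj_on (\<lambda>(r, s, t). r) L"
proof -
  have sub: "r + s + t = d" if "(r, s, t) \<in> L" for r s t
    using assms that by (auto simp: is_line_def Delta_def)
  consider (r) c where "\<And>r s t. (r, s, t) \<in> L \<Longrightarrow> r = c"
    | (s) c where "\<And>r s t. (r, s, t) \<in> L \<Longrightarrow> s = c"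
    | (t) c where "\<And>r s t. (r, s, t) \<in> L \<Longrightarrow> t = c"
    using assms unfolding is_line_def by blast
  then show ?thesis
  proof cases
    case r
    have *: "r = c \<and> r + s + t = d" if "(r, s, t) \<in> L" for r s t
      using r sub that by blast
    have "inj_on (\<lambda>(r, s, t). t) L"
      by (auto simp: inj_on_def dest!: *)
    then show ?thesis by (rule that)
  next
    case s
    have *: "s = c \<and> r + s + t = d" if "(r, s, t) \<in> L" for r s t
      using s sub that by blast
    have "inj_on (\<lambda>(r, s, t). t) L"
      by (auto simp: inj_on_def dest!: *)
    then show ?thesis by (rule that)
  next
    case t
    have *: "t = c \<and> r + s + t = d" if "(r, s, t) \<in> L" for r s t
      using t sub that by blast
    have "inj_on (\<lambda>(r, s, t). r) L"
      by (auto simp: inj_on_def dest!: *)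
    then show ?thesis by (rule that)
  qed
qed

theorem theorem5p8:
  fixes scale :: "'a::field \<Rightarrow> 'b::ab_group_add \<Rightarrow> 'b"
    and d :: nat
    and A :: "'b \<Rightarrow> 'b"
    and \<theta> :: "nat \<Rightarrow> 'a"
    and v :: "nat \<Rightarrow> 'b"
  assumes "vector_space scale"
    and "vector_space.dim scale (UNIV :: 'b set) = d + 1"
    and "Vector_Spaces.linear scale scale A"
    and "multiplicity_free scale A"
    and "bij_betw \<theta> {0..d} (eigenvalues scale A)"
    and "\<And>i. i \<le> d \<Longrightarrow> v i \<noteq> 0 \<and> v i \<in> eigenspace scale A (\<theta> i)"
  shows "concrete_billiard_array scale d
           (billiard_L scale d \<theta> A (\<Sum>i=0..d. v i))"
proof -
  interpret vector_space scale by fact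
  define w where "w r t i = poly (eta_poly d \<theta> r) (\<theta> i) * poly (tau_poly \<theta> t) (\<theta> i)" for r t i
  let ?B = "billiard_L scale d \<theta> A (\<Sum>i=0..d. v i)"
  have inj: "inj_on \<theta> {0..d}"
    using assms(5) by (rule bij_betw_imp_inj_on)
  have v: "v i \<noteq> 0" "v i \<in> eigenspace scale A (\<theta> i)" if "i \<in> {0..d}" for i
    using assms(6) that by auto
  have indep: "independent_family scale v {0..d}"
    using assms(3) inj v by (intro independent_family_eigenvectors) auto
  \<comment> \<open>The first instance, with all coefficients 1, computes
    \<open>\<tau>\<^sub>t(A)\<close> on the sum of the \<open>v i\<close>; the second applies
    \<open>\<eta>\<^sub>r(A)\<close> to the result.\<close>
  have B: "?B (r, s, t) = (\<Sum>i=0..d. scale (w r t i) (v i))" for r s t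
    using poly_map_eigenvector_sum[where v = v and \<theta> = \<theta>, OF assms(3) v(2),
        of "{0..d}" "tau_poly \<theta> t" "\<lambda>_. 1"]
      poly_map_eigenvector_sum[where v = v and \<theta> = \<theta>, OF assms(3) v(2),
        of "{0..d}" "eta_poly d \<theta> r" "\<lambda>i. poly (tau_poly \<theta> t) (\<theta> i)"]
    by (simp add: billiard_L_def w_def)
  have w0: "w r t i = 0 \<longleftrightarrow> i < t \<or> d - r < i" if "i \<le> d" "r \<le> d" "t \<le> d" for r t i
    using that by (auto simp: w_def poly_tau_eq_0_iff[OF inj] poly_eta_eq_0_iff[OF inj])
  have line: "independent_family scale ?B L" if L: "is_line d L" for L
  proof -
    have sub: "r + t \<le> d" if "(r, s, t) \<in> L" for r s t
      using L that by (auto simp: is_line_def Delta_def)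
    have fin: "finite L"
      using L finite_subset[OF _ finite_Delta] by (auto simp: is_line_def)
    show ?thesis
      using L
    proof (cases rule: is_line_cases)
      case 1
      \<comment> \<open>The pivot \<open>t\<close> lies in the support because
        \<open>t \<le> d - r\<close>; a row with larger third coordinate vanishes there.\<close>
      show ?thesis
        by (rule independent_family_triangular[OF _ indep fin 1,
              where c = "\<lambda>(r, s, t). w r t" and \<pi> = "\<lambda>(r, s, t). t"])
          (auto simp: B w0 dest!: sub)
    next
      case 2
      \<comment> \<open>Mirror image: a row with larger first coordinate \<open>r'\<close> has its
        support end at \<open>d - r' < d - r\<close>.\<close>
      show ?thesis
        by (rule independent_family_triangular[OF _ indep fin 2,
              where c = "\<lambda>(r, s, t). w r t" and \<pi> = "\<lambda>(r, s, t). d - r"])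
          (auto simp: B w0 dest!: sub)
    qed
  qed
  have clique: "\<not> independent_family scale ?B C" if "is_black_3_clique d C" for C
  proof -
    from that obtain r s t where rst: "r + s + t = d" "s \<ge> 1"
      and C: "C = {(r, s, t), (r + 1, s - 1, t), (r, s - 1, t + 1)}"
      by (auto simp: is_black_3_clique_iff Delta_def)
    \<comment> \<open>The coefficients of the identity for black cliques with all terms on one side.
      The coefficient 1 keeps the relation nontrivial.\<close>
    define a where "a l = (if l = (r, s, t) then \<theta> (d - r) - \<theta> t
      else if l = (r + 1, s - 1, t) then 1 else - 1)" for l :: location
    \<comment> \<open>The index of the new root in \<open>\<eta>\<^sub>r\<^sub>+\<^sub>1\<close>;
      the subtraction is exact because \<open>s \<ge> 1\<close> forces \<open>r < d\<close>.\<close>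
    have "d - Suc r + 1 = d - r"
      using rst by simp
    then have "(\<theta> (d - r) - \<theta> t) * w r t i + w (r + 1) t i - w r (t + 1) i = 0" for i
      by (simp add: w_def eta_poly_def tau_poly_def algebra_simps)
    then have "scale ((\<theta> (d - r) - \<theta> t) * w r t i) (v i) + scale (w (r + 1) t i) (v i)
        - scale (w r (t + 1) i) (v i) = 0" for i
      by (simp flip: scale_left_distrib scale_left_diff_distrib)
    then have "scale (\<theta> (d - r) - \<theta> t) (?B (r, s, t)) + ?B (r + 1, s - 1, t)
        - ?B (r, s - 1, t + 1) = 0"
      unfolding B by (simp add: scale_sum_right flip: sum.distrib sum_subtractf)
    then have "(\<Sum>l\<in>C. scale (a l) (?B l)) = 0"
      using rst by (simp add: C a_def algebra_simps)
    moreover have "a (r + 1, s - 1, t) \<noteq> 0" "(r + 1, s - 1, t) \<in> C" "finite C"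
      by (simp_all add: a_def C)
    ultimately show ?thesis
      by (auto simp: independent_family_iff)
  qed
  show ?thesis
    using line clique by (simp add: concrete_billiard_array_def)
qed

end
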